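(* Let $n\in\mathbb{N}$. For any Borel set $A\subset\mathbb{R}^n$ and any $t\ge10$, either $$\nu^n\big((A+tB_1^n)\cap 50\sqrt n\,B_2^n\big)\ge\tfrac12\nu^n(A)$$ or $$\nu^n(A+tB_1^n)\ge e^{t/10}\nu^n(A)$$ (at least one of the two holds). In particular the second inequality holds if $A\cap(50\sqrt n\,B_2^n+tB_1^n)=\emptyset$.
   Context: $\nu$ is the symmetric exponential distribution on $\mathbb{R}$, with density $\frac12e^{-|x|}$, and $\nu^n=\nu^{\otimes n}$ is the product measure on $\mathbb{R}^n$. $B_p^n=\{x\in\mathbb{R}^n:\|x\|_p\le1\}$. *)

theory Defs
  imports "HOL-Probability.Probability" "HOL-Library.Set_Algebras"
begin

definition sym_exp :: "real measure" where
  "sym_exp = density lborel (\<lambda>x. ennreal (1 / 2 * exp (- \<bar>x\<bar>)))"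

text \<open>The library's product measure lives on functions; it is transported to
  \<^typ>\<open>real ^ 'n\<close> along the canonical bijection.\<close>

definition sym_exp_prod :: "(real ^ 'n) measure" where
  "sym_exp_prod = distr (Pi\<^sub>M UNIV (\<lambda>_. sym_exp)) borel (\<lambda>f. \<chi> i. f i)"

text \<open>Intended for real exponents \<open>p \<ge> 1\<close>.\<close>

definition lp_norm :: "real \<Rightarrow> real ^ 'n \<Rightarrow> real" where
  "lp_norm p x = (\<Sum>i\<in>UNIV. \<bar>x $ i\<bar> powr p) powr (1 / p)"

definition lp_ball :: "real \<Rightarrow> (real ^ 'n) set" where
  "lp_ball p = {x. lp_norm p x \<le> 1}"

text \<open>For a Borel set \<open>A\<close> the Minkowski sum of \<open>A\<close> and a dilated ball need not be Borel,
  only Lebesgue measurable (the library's \<^const>\<open>measure\<close> is 0 on sets outside the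
  sigma-algebra). Its measure is therefore taken in the completion, which agrees with the
  product measure on Borel sets.\<close>

abbreviation sym_exp_prob :: "(real ^ 'n) set \<Rightarrow> real" where
  "sym_exp_prob S \<equiv> measure (completion sym_exp_prod) S"

abbreviation dilate :: "real \<Rightarrow> (real ^ 'n) set \<Rightarrow> (real ^ 'n) set" where
  "dilate c S \<equiv> (*\<^sub>R) c ` S"

end

theory Submission imports Defs begin

text \<open>
  Write \<open>\<nu>\<close> for the product measure, \<open>n\<close> for the dimension, \<open>G\<close> for the Euclidean ball of radius
  \<open>50 \<surd>n\<close> and \<open>e\<^sub>i\<close> for the unit vectors. Everything rests on the fact that moving a single
  coordinate \<open>x\<^sub>i\<close> by \<open>h\<close> towards \<open>0\<close> preserves Lebesgue measure, is a displacement of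
  \<open>\<ell>\<^sub>1\<close>-length \<open>h\<close>, and multiplies the density by \<open>exp h\<close> as long as \<open>\<bar>x\<^sub>i\<bar> \<ge> h\<close>.

  Let \<open>10 \<le> h \<le> 20\<close>, and let \<open>B\<close> be a set outside \<open>G\<close>. At a point of \<open>B\<close> the coordinates with
  \<open>\<bar>x\<^sub>i\<bar> < 40\<close> contribute at most \<open>1600 n\<close> to \<open>\<Sum> x\<^sub>i\<^sup>2 \<ge> 2500 n\<close>, so coordinates that can be moved exist,
  but there may be many of them, and the translates of \<open>B\<close> may overlap \<open>n\<close> times. Therefore
  the mass at \<open>x\<close> is split among the moves, the share of the \<open>i\<close>-th being
  \<open>x\<^sub>i\<^sup>2 / \<Sum> x\<^sub>j\<^sup>2\<close>. The shares of the moves with \<open>\<bar>x\<^sub>i\<bar> \<ge> 40\<close> add up to at least \<open>9 / 25\<close>. A point \<open>y\<close>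
  receives mass only from points \<open>y \<plusminus> h e\<^sub>i\<close> with \<open>\<bar>y\<^sub>i\<bar> \<ge> 20\<close>; passing from \<open>y\<close> to such a point at
  most doubles the \<open>i\<close>-th coordinate and does not decrease the Euclidean norm, so the shares arriving
  at \<open>y\<close> add up to at most \<open>4\<close>. Hence \<open>\<nu>(B + h B\<^sub>1) \<ge> (9 / 100) exp h \<nu>(B)\<close>
  (\<open>measure_one_coordinate_step\<close>).

  If at most half of \<open>A\<close> lies in \<open>G\<close>, this applied to the rest of \<open>A\<close> gives
  \<open>\<nu>(A + h B\<^sub>1) \<ge> exp (h / 10) \<nu>(A)\<close> (\<open>growth_step\<close>). For general \<open>t \<ge> 10\<close>, write \<open>t = m h\<close> and iterate:
  either the measure grows at every step, or at some step at least half of the current set, whose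
  measure is no smaller than \<open>\<nu>(A)\<close>, lies in \<open>G\<close> (\<open>growth_iterate\<close>). The iteration produces Borel
  subsets of the Minkowski sums.

  It remains to know that \<open>A + t B\<^sub>1\<close> is measurable for the completion
  (\<open>add_l1_ball_in_completion\<close>). It contains the open set of points at \<open>\<ell>\<^sub>1\<close>-distance less than \<open>t\<close>
  from \<open>A\<close>, and the other points lie on the level set \<open>t\<close> of the distance. These can be moved along
  finitely many coordinate directions into a level set \<open>r < t\<close>; all but countably many level sets are
  null, and coordinate translations preserve null sets.
\<close>

section \<open>The norms and balls in coordinates\<close>

definition l1_norm :: "real ^ 'n \<Rightarrow> real" where
  "l1_norm x = (\<Sum>i\<in>UNIV. \<bar>x $ i\<bar>)"

definition sq_norm :: "real ^ 'n \<Rightarrow> real" where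
  "sq_norm x = (\<Sum>i\<in>UNIV. (x $ i)\<^sup>2)"

lemma dilate_lp_ball:
  assumes "r > 0"
  shows "dilate r (lp_ball p) = {x. lp_norm p ((1 / r) *\<^sub>R x) \<le> 1}"
proof (intro set_eqI iffI)
  fix x assume "x \<in> {x. lp_norm p ((1 / r) *\<^sub>R x) \<le> 1}"
  then show "x \<in> dilate r (lp_ball p)"
    using assms by (intro image_eqI[of _ _ "(1 / r) *\<^sub>R x"]) (auto simp: lp_ball_def)
qed (use assms in \<open>auto simp: lp_ball_def\<close>)

lemma dilate_lp_ball_1:
  assumes "r > 0"
  shows "dilate r (lp_ball 1) = {x :: real ^ 'n. l1_norm x \<le> r}"
proof -
  have "lp_norm 1 ((1 / r) *\<^sub>R x) = l1_norm x / r" for x :: "real ^ 'n"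
    using assms by (simp add: lp_norm_def l1_norm_def abs_mult sum_nonneg flip: sum_divide_distrib)
  then show ?thesis
    using assms by (simp add: dilate_lp_ball)
qed

lemma dilate_lp_ball_2:
  assumes "r > 0"
  shows "dilate r (lp_ball 2) = {x :: real ^ 'n. sq_norm x \<le> r\<^sup>2}"
proof -
  have "lp_norm 2 ((1 / r) *\<^sub>R x) = sqrt (sq_norm x / r\<^sup>2)" for x :: "real ^ 'n"
    using assms
    by (simp add: lp_norm_def sq_norm_def powr_half_sqrt sum_nonneg power_divide
        flip: sum_divide_distrib)
  then show ?thesis
    using assms by (simp add: dilate_lp_ball)
qed

lemma add_dilate_lp_ball_1:
  fixes A :: "(real ^ 'n) set"
  assumes "t > 0"
  shows "A + dilate t (lp_ball 1) = {x. \<exists>a\<in>A. l1_norm (x - a) \<le> t}"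
proof (intro set_eqI iffI)
  fix x assume "x \<in> {x. \<exists>a\<in>A. l1_norm (x - a) \<le> t}"
  then obtain a where "a \<in> A" "l1_norm (x - a) \<le> t"
    by auto
  then show "x \<in> A + dilate t (lp_ball 1)"
    using assms set_plus_intro[of a A "x - a"] by (simp add: dilate_lp_ball_1)
next
  fix x assume "x \<in> A + dilate t (lp_ball 1)"
  then obtain a b where "x = a + b" "a \<in> A" "l1_norm b \<le> t"
    using assms by (auto simp: dilate_lp_ball_1 elim!: set_plus_elim)
  then show "x \<in> {x. \<exists>a\<in>A. l1_norm (x - a) \<le> t}"
    by (auto intro!: bexI[of _ a])
qed

lemma l1_norm_triangle: "l1_norm (x + y) \<le> l1_norm x + l1_norm y"
  unfolding l1_norm_def by (simp add: sum_mono flip: sum.distrib)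

lemma l1_norm_minus_commute: "l1_norm (x - y) = l1_norm (y - x)"
  by (simp add: l1_norm_def abs_minus_commute)

lemma l1_norm_axis [simp]: "l1_norm (axis i c) = \<bar>c\<bar>"
  by (simp add: l1_norm_def axis_def if_distrib[of abs] cong: if_cong)

lemma continuous_on_l1_norm [continuous_intros]:
  "continuous_on S f \<Longrightarrow> continuous_on S (\<lambda>x. l1_norm (f x))"
  unfolding l1_norm_def by (intro continuous_intros)

lemma vec_nth_borel_measurable [measurable]:
  "(\<lambda>x :: real ^ 'n. x $ i) \<in> borel_measurable borel"
  by (intro borel_measurable_continuous_onI continuous_intros)

lemma sq_norm_measurable [measurable]: "sq_norm \<in> borel_measurable borel"
  unfolding sq_norm_def by measurable

section \<open>The product measure and coordinate translations\<close>

lemma sets_sym_exp [measurable_cong, simp]: "sets sym_exp = sets borel"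
  by (simp add: sym_exp_def)

lemma space_sym_exp [simp]: "space sym_exp = UNIV"
  by (simp add: sym_exp_def)

lemma prob_space_sym_exp: "prob_space sym_exp"
proof
  let ?d = "\<lambda>x :: real. ennreal (1 / 2 * exp (- \<bar>x\<bar>))"
  have half: "(\<integral>\<^sup>+x\<in>{0..}. ?d x \<partial>lborel) = ennreal (1 / 2)"
  proof -
    have "(\<integral>\<^sup>+x\<in>{0..}. ennreal (1 / 2 * exp (- x)) \<partial>lborel) = ennreal (0 - (- 1 / 2 * exp (- 0)))"
      by (rule nn_integral_FTC_atLeast) (auto intro!: derivative_eq_intros, real_asymp)
    moreover have "(\<integral>\<^sup>+x\<in>{0..}. ?d x \<partial>lborel) = (\<integral>\<^sup>+x\<in>{0..}. ennreal (1 / 2 * exp (- x)) \<partial>lborel)"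
      by (intro nn_integral_cong) (auto split: split_indicator)
    ultimately show ?thesis by simp
  qed
  have "(\<integral>\<^sup>+x\<in>{..0}. ?d x \<partial>lborel) = (\<integral>\<^sup>+x\<in>{0..}. ?d x \<partial>lborel)"
    by (subst nn_integral_real_affine[where c = "-1" and t = 0])
      (auto intro!: nn_integral_cong split: split_indicator)
  moreover have "(\<integral>\<^sup>+x. ?d x \<partial>lborel)
      = (\<integral>\<^sup>+x. ?d x * indicator {0..} x + ?d x * indicator {..0} x \<partial>lborel)"
    by (intro nn_integral_cong_AE eventually_mono[OF AE_lborel_singleton[of 0]])
      (auto split: split_indicator)
  ultimately have "(\<integral>\<^sup>+x. ?d x \<partial>lborel) = ennreal (1 / 2) + ennreal (1 / 2)"
    using half by (simp add: nn_integral_add)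
  also have "\<dots> = 1"
    by (subst ennreal_plus[symmetric]) simp_all
  finally show "emeasure sym_exp (space sym_exp) = 1"
    by (simp add: sym_exp_def emeasure_density)
qed

interpretation sym_exp: product_prob_space "\<lambda>_. sym_exp" "UNIV :: 'n::finite set"
  unfolding product_prob_space_def product_prob_space_axioms_def product_sigma_finite_def
  using prob_space_sym_exp prob_space_imp_sigma_finite by blast

lemma measurable_vec_lambda [measurable]:
  "(\<lambda>f. \<chi> i. f i) \<in> measurable (Pi\<^sub>M UNIV (\<lambda>_. sym_exp)) (borel :: (real ^ 'n) measure)"
proof (subst borel_measurable_euclidean_space, intro ballI)
  fix b :: "real ^ 'n" assume "b \<in> Basis"
  then obtain i where "b = axis i 1"
    by (auto simp: Basis_vec_def)
  then have "(\<lambda>f :: 'n \<Rightarrow> real. (\<chi> i. f i) \<bullet> b) = (\<lambda>f. f i)"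
    by (simp add: fun_eq_iff inner_axis)
  moreover have "(\<lambda>f. f i) \<in> borel_measurable (Pi\<^sub>M UNIV (\<lambda>_ :: 'n. sym_exp))"
    by measurable
  ultimately show "(\<lambda>f. (\<chi> i. f i) \<bullet> b) \<in> borel_measurable (Pi\<^sub>M UNIV (\<lambda>_. sym_exp))"
    by (simp only:)
qed

lemma sets_sym_exp_prod [measurable_cong, simp]: "sets sym_exp_prod = sets borel"
  by (simp add: sym_exp_prod_def)

lemma space_sym_exp_prod [simp]: "space sym_exp_prod = UNIV"
  by (simp add: sym_exp_prod_def)

interpretation sym_exp_prod: prob_space "sym_exp_prod :: (real ^ 'n) measure"
  unfolding sym_exp_prod_def by (rule sym_exp.prob_space_distr[OF measurable_vec_lambda])

lemma nn_integral_sym_exp_shift: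
  assumes [measurable]: "g \<in> borel_measurable borel"
  shows "(\<integral>\<^sup>+y. g (y + s) \<partial>sym_exp) = (\<integral>\<^sup>+y. g y * ennreal (exp (\<bar>y\<bar> - \<bar>y - s\<bar>)) \<partial>sym_exp)"
proof -
  let ?d = "\<lambda>x :: real. ennreal (1 / 2 * exp (- \<bar>x\<bar>))"
  have "(\<integral>\<^sup>+y. g (y + s) \<partial>sym_exp) = (\<integral>\<^sup>+y. ?d y * g (y + s) \<partial>lborel)"
    by (simp add: sym_exp_def nn_integral_density)
  also have "\<dots> = (\<integral>\<^sup>+y. ?d (y - s) * g y \<partial>lborel)"
    by (subst nn_integral_real_affine[where c = 1 and t = "- s"]) auto
  also have "\<dots> = (\<integral>\<^sup>+y. ?d y * (g y * ennreal (exp (\<bar>y\<bar> - \<bar>y - s\<bar>))) \<partial>lborel)"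
  proof (intro nn_integral_cong)
    fix y
    have "?d (y - s) = ?d y * ennreal (exp (\<bar>y\<bar> - \<bar>y - s\<bar>))"
      by (simp add: exp_diff exp_minus field_simps flip: ennreal_mult)
    then show "?d (y - s) * g y = ?d y * (g y * ennreal (exp (\<bar>y\<bar> - \<bar>y - s\<bar>)))"
      by (simp add: mult_ac)
  qed
  also have "\<dots> = (\<integral>\<^sup>+y. g y * ennreal (exp (\<bar>y\<bar> - \<bar>y - s\<bar>)) \<partial>sym_exp)"
    by (simp add: sym_exp_def nn_integral_density)
  finally show ?thesis .
qed

text \<open>Fubini for a single coordinate; it reduces statements about moving one coordinate to the line.\<close>

lemma nn_integral_sym_exp_prod_coordinate:
  fixes f :: "real ^ 'n \<Rightarrow> ennreal" and i :: 'n
  assumes [measurable]: "f \<in> borel_measurable borel"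
  shows "(\<integral>\<^sup>+x. f x \<partial>sym_exp_prod) =
    (\<integral>\<^sup>+w. (\<integral>\<^sup>+y. f (\<chi> j. (w(i := y)) j) \<partial>sym_exp) \<partial>Pi\<^sub>M (UNIV - {i}) (\<lambda>_. sym_exp))"
proof -
  have U: "insert i (UNIV - {i}) = UNIV" by auto
  have "(\<integral>\<^sup>+x. f x \<partial>sym_exp_prod) = (\<integral>\<^sup>+w. f (\<chi> j. w j) \<partial>Pi\<^sub>M UNIV (\<lambda>_. sym_exp))"
    unfolding sym_exp_prod_def by (rule nn_integral_distr) measurable
  also have "\<dots> = (\<integral>\<^sup>+w. f (\<chi> j. w j) \<partial>Pi\<^sub>M (insert i (UNIV - {i})) (\<lambda>_. sym_exp))"
    by (simp only: U)
  also have "\<dots> = (\<integral>\<^sup>+w. (\<integral>\<^sup>+y. f (\<chi> j. (w(i := y)) j) \<partial>sym_exp) \<partial>Pi\<^sub>M (UNIV - {i}) (\<lambda>_. sym_exp))"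
    by (rule sym_exp.product_nn_integral_insert) (simp_all only: U, measurable)
  finally show ?thesis .
qed

lemma continuous_on_axis: "continuous_on S (\<lambda>c :: real. axis i c :: real ^ 'n)"
proof -
  have "(\<lambda>c :: real. axis i c :: real ^ 'n) = (\<lambda>c. c *\<^sub>R axis i 1)"
    by (auto simp: vec_eq_iff axis_def)
  moreover have "continuous_on S (\<lambda>c :: real. c *\<^sub>R axis i 1 :: real ^ 'n)"
    by (intro continuous_intros)
  ultimately show ?thesis
    by metis
qed

lemma add_axis_measurable [measurable]: "(\<lambda>y :: real ^ 'n. y + axis i c) \<in> borel_measurable borel"
  by (intro borel_measurable_continuous_onI continuous_intros)

text \<open>Lebesgue measure is translation invariant, so a translation costs only the quotient of the
  densities \<open>exp (- \<bar>y - s\<bar>)\<close> and \<open>exp (- \<bar>y\<bar>)\<close> in the translated coordinate.\<close>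

lemma nn_integral_sym_exp_prod_shift:
  fixes f :: "real ^ 'n \<Rightarrow> ennreal"
  assumes [measurable]: "f \<in> borel_measurable borel"
  shows "(\<integral>\<^sup>+x. f (x + axis i s) \<partial>sym_exp_prod) =
    (\<integral>\<^sup>+x. f x * ennreal (exp (\<bar>x $ i\<bar> - \<bar>x $ i - s\<bar>)) \<partial>sym_exp_prod)"
proof -
  define F where "F w y = f (\<chi> j. (w(i := y)) j)" for w y
  have F_meas: "F w \<in> borel_measurable borel" for w
  proof -
    have "F w = (\<lambda>y. f ((\<chi> j. (w(i := 0)) j) + axis i y))"
      unfolding F_def by (intro ext arg_cong[where f = f]) (auto simp: vec_eq_iff axis_def)
    moreover have "(\<lambda>y. (\<chi> j. (w(i := 0)) j) + axis i y) \<in> borel_measurable (borel :: real measure)"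
      by (intro borel_measurable_continuous_onI continuous_intros continuous_on_axis)
    ultimately show ?thesis
      using measurable_compose[OF _ assms] by simp
  qed
  have shift: "(\<chi> j. (w(i := y)) j) + axis i s = (\<chi> j. (w(i := y + s)) j)" for w y
    by (auto simp: vec_eq_iff axis_def)
  have "(\<lambda>x. f (x + axis i s)) \<in> borel_measurable borel"
    by measurable
  then have "(\<integral>\<^sup>+x. f (x + axis i s) \<partial>sym_exp_prod) =
      (\<integral>\<^sup>+w. (\<integral>\<^sup>+y. F w (y + s) \<partial>sym_exp) \<partial>Pi\<^sub>M (UNIV - {i}) (\<lambda>_. sym_exp))"
    by (subst nn_integral_sym_exp_prod_coordinate[where i = i]) (simp_all only: shift F_def)
  also have "\<dots> = (\<integral>\<^sup>+w. (\<integral>\<^sup>+y. F w y * ennreal (exp (\<bar>y\<bar> - \<bar>y - s\<bar>)) \<partial>sym_exp)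
      \<partial>Pi\<^sub>M (UNIV - {i}) (\<lambda>_. sym_exp))"
    by (simp only: nn_integral_sym_exp_shift[OF F_meas])
  also have "\<dots> = (\<integral>\<^sup>+x. f x * ennreal (exp (\<bar>x $ i\<bar> - \<bar>x $ i - s\<bar>)) \<partial>sym_exp_prod)"
  proof (subst nn_integral_sym_exp_prod_coordinate[where i = i])
    show "(\<lambda>x. f x * ennreal (exp (\<bar>x $ i\<bar> - \<bar>x $ i - s\<bar>))) \<in> borel_measurable borel"
      by measurable
  qed (simp only: F_def vec_lambda_beta fun_upd_same)
  finally show ?thesis .
qed

section \<open>Growth outside the Euclidean ball\<close>

lemma sq_norm_bounds:
  fixes x :: "real ^ 'n"
  shows "0 \<le> sq_norm x" and "(x $ i)\<^sup>2 \<le> sq_norm x"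
  unfolding sq_norm_def by (auto intro!: sum_nonneg member_le_sum)

text \<open>The union of the translates by \<open>- \<sigma> h e\<^sub>i\<close> of the parts \<open>\<sigma> x\<^sub>i \<ge> 40\<close> of \<open>B\<close>, for all
  coordinates \<open>i\<close> and signs \<open>\<sigma>\<close>; the inequality is the condition on \<open>x = y + \<sigma> h e\<^sub>i\<close> in terms of \<open>y\<close>.\<close>

definition one_coordinate_step :: "real \<Rightarrow> (real ^ 'n) set \<Rightarrow> (real ^ 'n) set" where
  "one_coordinate_step h B =
    (\<Union>i. \<Union>\<sigma>\<in>{-1, 1}. {y. y + axis i (\<sigma> * h) \<in> B \<and> \<sigma> * (y $ i) + h \<ge> 40})"

lemma one_coordinate_step_borel [measurable]:
  assumes [measurable]: "B \<in> sets borel"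
  shows "one_coordinate_step h B \<in> sets borel"
  unfolding one_coordinate_step_def by (intro sets.finite_UN) auto

lemma one_coordinate_step_subset:
  assumes "h > 0"
  shows "one_coordinate_step h B \<subseteq> B + dilate h (lp_ball 1)"
proof
  fix y assume "y \<in> one_coordinate_step h B"
  then obtain i \<sigma> where "\<sigma> \<in> {-1, 1}" "y + axis i (\<sigma> * h) \<in> B"
    unfolding one_coordinate_step_def by blast
  moreover have "y - (y + axis i (\<sigma> * h)) = axis i (- \<sigma> * h)"
    by (simp add: vec_eq_iff axis_def)
  ultimately show "y \<in> B + dilate h (lp_ball 1)"
    using assms by (auto simp: add_dilate_lp_ball_1 intro!: bexI[of _ "y + axis i (\<sigma> * h)"])
qed

text \<open>Integrate the shares \<open>g i \<sigma>\<close> of the moves. Before the moves they sum to at least \<open>9 / 25\<close> on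
  \<open>B\<close>; after the moves they sum to at most \<open>4\<close> on the union of the translates and vanish elsewhere;
  each move multiplies the integral of its share by \<open>exp h\<close>. The quotient of the two bounds is the
  constant.\<close>

lemma measure_one_coordinate_step:
  fixes B :: "(real ^ 'n) set"
  assumes [measurable]: "B \<in> sets borel"
    and far: "\<And>x. x \<in> B \<Longrightarrow> sq_norm x \<ge> 2500 * real CARD('n)"
    and h: "0 \<le> h" "h \<le> 20"
  shows "9 / 100 * exp h * measure sym_exp_prod B \<le> measure sym_exp_prod (one_coordinate_step h B)"
proof -
  define g :: "'n \<Rightarrow> real \<Rightarrow> real ^ 'n \<Rightarrow> real" where
    "g i \<sigma> x = (if x \<in> B \<and> \<sigma> * (x $ i) \<ge> 40 then (x $ i)\<^sup>2 / sq_norm x else 0)" for i \<sigma> x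
  let ?S = "{-1, 1} :: real set"
  have [measurable]: "g i \<sigma> \<in> borel_measurable borel" for i \<sigma>
    unfolding g_def by measurable
  have g_nonneg: "g i \<sigma> x \<ge> 0" for i \<sigma> x
    by (simp add: g_def sq_norm_bounds)
  have lower: "9 / 25 \<le> (\<Sum>i\<in>UNIV. \<Sum>\<sigma>\<in>?S. g i \<sigma> x)" if "x \<in> B" for x
  proof -
    have N: "sq_norm x \<ge> 2500 * real CARD('n)" "sq_norm x > 0"
      using far[OF that] by (auto intro: less_le_trans[rotated])
    \<comment> \<open>If \<open>\<bar>x\<^sub>i\<bar> < 40\<close> there is no move, but then the left-hand side is negative.\<close>
    have "((x $ i)\<^sup>2 - 1600) / sq_norm x \<le> (\<Sum>\<sigma>\<in>?S. g i \<sigma> x)" for i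
    proof (cases "\<bar>x $ i\<bar> \<ge> 40")
      case True
      then show ?thesis
        using that N by (auto simp: g_def field_simps abs_if split: if_splits)
    next
      case False
      then have "\<bar>x $ i\<bar>\<^sup>2 \<le> 40\<^sup>2"
        by (intro power_mono) auto
      then show ?thesis
        using N g_nonneg by (intro order_trans[OF divide_nonpos_nonneg]) (auto intro!: sum_nonneg)
    qed
    then have "(\<Sum>i\<in>UNIV. ((x $ i)\<^sup>2 - 1600) / sq_norm x) \<le> (\<Sum>i\<in>UNIV. \<Sum>\<sigma>\<in>?S. g i \<sigma> x)"
      by (intro sum_mono)
    moreover have "(\<Sum>i\<in>UNIV. ((x $ i)\<^sup>2 - 1600) / sq_norm x)
        = (sq_norm x - 1600 * real CARD('n)) / sq_norm x"
      by (simp add: sq_norm_def sum_subtractf flip: sum_divide_distrib)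
    moreover have "9 / 25 \<le> (sq_norm x - 1600 * real CARD('n)) / sq_norm x"
      using N by (simp add: field_simps)
    ultimately show ?thesis by linarith
  qed
  have upper: "(\<Sum>i\<in>UNIV. \<Sum>\<sigma>\<in>?S. g i \<sigma> (y + axis i (\<sigma> * h)))
      \<le> 4 * indicator (one_coordinate_step h B) y" for y
  proof (cases "y \<in> one_coordinate_step h B")
    case False
    have "g i \<sigma> (y + axis i (\<sigma> * h)) = 0" if "\<sigma> \<in> ?S" for i \<sigma>
      using False that by (auto simp: g_def one_coordinate_step_def axis_def algebra_simps)
    then show ?thesis
      using False by simp
  next
    case True
    \<comment> \<open>The sign condition on the right lets at most one of the two \<open>\<sigma>\<close> contribute for each \<open>i\<close>.\<close>
    have summand: "g i \<sigma> (y + axis i (\<sigma> * h)) \<le> (if \<sigma> * (y $ i) > 0 then 4 * (y $ i)\<^sup>2 / sq_norm y else 0)"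
      if "\<sigma> \<in> ?S" for i \<sigma>
    proof (cases "\<sigma> * (y $ i) \<ge> 20")
      case False
      then have "g i \<sigma> (y + axis i (\<sigma> * h)) = 0"
        using that h by (auto simp: g_def axis_def algebra_simps)
      then show ?thesis
        by (simp add: sq_norm_bounds)
    next
      case True
      let ?x = "y + axis i (\<sigma> * h)"
      have abs_le: "\<bar>y $ i\<bar> \<le> \<bar>?x $ i\<bar>" "\<bar>?x $ i\<bar> \<le> \<bar>2 * y $ i\<bar>"
        using True that h by (auto simp: axis_def)
      have "(y $ j)\<^sup>2 \<le> (?x $ j)\<^sup>2" for j
        using abs_le(1) by (cases "j = i") (auto simp: axis_def abs_le_square_iff)
      then have N: "sq_norm y \<le> sq_norm ?x"
        unfolding sq_norm_def by (intro sum_mono)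
      have "y $ i \<noteq> 0" using True by auto
      then have N0: "0 < sq_norm y"
        using sq_norm_bounds(2)[of y i] by (metis less_le_trans zero_less_power2)
      have "(?x $ i)\<^sup>2 \<le> 4 * (y $ i)\<^sup>2"
        using abs_le(2) unfolding abs_le_square_iff by (simp add: power_mult_distrib)
      then have "(?x $ i)\<^sup>2 / sq_norm ?x \<le> 4 * (y $ i)\<^sup>2 / sq_norm y"
        using N N0 by (intro frac_le) auto
      then show ?thesis
        using True N0 by (auto simp: g_def)
    qed
    have "(\<Sum>\<sigma>\<in>?S. g i \<sigma> (y + axis i (\<sigma> * h))) \<le> 4 * (y $ i)\<^sup>2 / sq_norm y" for i
    proof -
      have "(\<Sum>\<sigma>\<in>?S. g i \<sigma> (y + axis i (\<sigma> * h)))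
          \<le> (\<Sum>\<sigma>\<in>?S. if \<sigma> * (y $ i) > 0 then 4 * (y $ i)\<^sup>2 / sq_norm y else 0)"
        by (intro sum_mono summand)
      also have "\<dots> \<le> 4 * (y $ i)\<^sup>2 / sq_norm y"
        by (auto simp: sq_norm_bounds)
      finally show ?thesis .
    qed
    then have "(\<Sum>i\<in>UNIV. \<Sum>\<sigma>\<in>?S. g i \<sigma> (y + axis i (\<sigma> * h)))
        \<le> (\<Sum>i\<in>UNIV. 4 * (y $ i)\<^sup>2 / sq_norm y)"
      by (intro sum_mono)
    also have "\<dots> = 4 * (sq_norm y / sq_norm y)"
      by (simp add: sq_norm_def flip: sum_divide_distrib sum_distrib_left)
    also have "\<dots> \<le> 4"
      by simp
    finally show ?thesis
      using True by simp
  qed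
  have shift: "(\<integral>\<^sup>+y. ennreal (g i \<sigma> (y + axis i (\<sigma> * h))) \<partial>sym_exp_prod)
      = ennreal (exp h) * (\<integral>\<^sup>+x. ennreal (g i \<sigma> x) \<partial>sym_exp_prod)" if "\<sigma> \<in> ?S" for i \<sigma>
  proof -
    have "(\<integral>\<^sup>+y. ennreal (g i \<sigma> (y + axis i (\<sigma> * h))) \<partial>sym_exp_prod)
        = (\<integral>\<^sup>+x. ennreal (g i \<sigma> x) * ennreal (exp (\<bar>x $ i\<bar> - \<bar>x $ i - \<sigma> * h\<bar>)) \<partial>sym_exp_prod)"
      by (rule nn_integral_sym_exp_prod_shift) measurable
    also have "\<dots> = (\<integral>\<^sup>+x. ennreal (exp h) * ennreal (g i \<sigma> x) \<partial>sym_exp_prod)"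
    proof (intro nn_integral_cong)
      fix x :: "real ^ 'n"
      show "ennreal (g i \<sigma> x) * ennreal (exp (\<bar>x $ i\<bar> - \<bar>x $ i - \<sigma> * h\<bar>))
          = ennreal (exp h) * ennreal (g i \<sigma> x)"
      proof (cases "\<sigma> * (x $ i) \<ge> 40")
        case True
        then have "\<bar>x $ i\<bar> - \<bar>x $ i - \<sigma> * h\<bar> = h"
          using that h by auto
        then show ?thesis by (simp add: mult.commute)
      qed (simp add: g_def)
    qed
    also have "\<dots> = ennreal (exp h) * (\<integral>\<^sup>+x. ennreal (g i \<sigma> x) \<partial>sym_exp_prod)"
      by (intro nn_integral_cmult) measurable
    finally show ?thesis .
  qed
  have "ennreal (9 / 25) * emeasure sym_exp_prod B
      = (\<integral>\<^sup>+x. ennreal (9 / 25) * indicator B x \<partial>sym_exp_prod)"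
    by (simp add: nn_integral_cmult_indicator)
  also have "\<dots> \<le> (\<integral>\<^sup>+x. (\<Sum>i\<in>UNIV. \<Sum>\<sigma>\<in>?S. ennreal (g i \<sigma> x)) \<partial>sym_exp_prod)"
  proof (intro nn_integral_mono)
    fix x :: "real ^ 'n"
    show "ennreal (9 / 25) * indicator B x \<le> (\<Sum>i\<in>UNIV. \<Sum>\<sigma>\<in>?S. ennreal (g i \<sigma> x))"
      using lower[of x] ennreal_leI[of "9 / 25"] g_nonneg
      by (auto simp: sum_ennreal sum_nonneg simp del: sum.insert split: split_indicator)
  qed
  also have "\<dots> = (\<Sum>i\<in>UNIV. \<Sum>\<sigma>\<in>?S. \<integral>\<^sup>+x. ennreal (g i \<sigma> x) \<partial>sym_exp_prod)"
    by (simp add: nn_integral_sum nn_integral_add)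
  finally have "ennreal (exp h) * (ennreal (9 / 25) * emeasure sym_exp_prod B)
      \<le> ennreal (exp h) * (\<Sum>i\<in>UNIV. \<Sum>\<sigma>\<in>?S. \<integral>\<^sup>+x. ennreal (g i \<sigma> x) \<partial>sym_exp_prod)"
    by (rule mult_left_mono) simp
  also have "\<dots> = (\<Sum>i\<in>UNIV. \<Sum>\<sigma>\<in>?S. \<integral>\<^sup>+y. ennreal (g i \<sigma> (y + axis i (\<sigma> * h))) \<partial>sym_exp_prod)"
    unfolding sum_distrib_left by (intro sum.cong refl) (simp only: shift)
  also have "\<dots> = (\<integral>\<^sup>+y. (\<Sum>i\<in>UNIV. \<Sum>\<sigma>\<in>?S. ennreal (g i \<sigma> (y + axis i (\<sigma> * h)))) \<partial>sym_exp_prod)"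
    by (simp add: nn_integral_sum nn_integral_add)
  also have "\<dots> \<le> (\<integral>\<^sup>+y. ennreal 4 * indicator (one_coordinate_step h B) y \<partial>sym_exp_prod)"
  proof (intro nn_integral_mono)
    fix y :: "real ^ 'n"
    show "(\<Sum>i\<in>UNIV. \<Sum>\<sigma>\<in>?S. ennreal (g i \<sigma> (y + axis i (\<sigma> * h))))
        \<le> ennreal 4 * indicator (one_coordinate_step h B) y"
    proof -
      have "(\<Sum>i\<in>UNIV. \<Sum>\<sigma>\<in>?S. ennreal (g i \<sigma> (y + axis i (\<sigma> * h))))
          = ennreal (\<Sum>i\<in>UNIV. \<Sum>\<sigma>\<in>?S. g i \<sigma> (y + axis i (\<sigma> * h)))"
        using g_nonneg by (simp add: sum_ennreal sum_nonneg del: sum.insert)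
      also have "\<dots> \<le> ennreal (4 * indicator (one_coordinate_step h B) y)"
        by (rule ennreal_leI[OF upper])
      also have "\<dots> = ennreal 4 * indicator (one_coordinate_step h B) y"
        by (simp split: split_indicator)
      finally show ?thesis .
    qed
  qed
  also have "\<dots> = ennreal 4 * emeasure sym_exp_prod (one_coordinate_step h B)"
    by (intro nn_integral_cmult_indicator) simp
  finally show ?thesis
    by (simp add: sym_exp_prod.emeasure_eq_measure flip: ennreal_mult del: ennreal_numeral)
qed

text \<open>The part of \<open>A\<close> outside the ball carries at least half of its measure, and the factor
  \<open>(9 / 100) exp h\<close> for that part exceeds \<open>2 exp (h / 10)\<close> by far, because \<open>exp (9 h / 10) \<ge> exp 9\<close>.\<close>

lemma growth_step:
  fixes A :: "(real ^ 'n) set"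
  defines "G \<equiv> {x :: real ^ 'n. sq_norm x \<le> 2500 * real CARD('n)}"
  assumes [measurable]: "A \<in> sets borel" and h: "10 \<le> h" "h \<le> 20"
    and less: "measure sym_exp_prod (A \<inter> G) \<le> 1 / 2 * measure sym_exp_prod A"
  obtains A' where "A' \<in> sets borel" "A' \<subseteq> A + dilate h (lp_ball 1)"
    "exp (h / 10) * measure sym_exp_prod A \<le> measure sym_exp_prod A'"
proof
  have [measurable]: "G \<in> sets borel"
    unfolding G_def by measurable
  show "one_coordinate_step h (A - G) \<in> sets borel"
    by measurable
  show "one_coordinate_step h (A - G) \<subseteq> A + dilate h (lp_ball 1)"
    using one_coordinate_step_subset[of h "A - G"] h set_plus_mono2[of "A - G" A] by fastforce
  have "measure sym_exp_prod A = measure sym_exp_prod (A \<inter> G) + measure sym_exp_prod (A - G)"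
    by (subst sym_exp_prod.finite_measure_Union[symmetric]) (auto intro: arg_cong[where f = "measure _"])
  then have half: "measure sym_exp_prod A \<le> 2 * measure sym_exp_prod (A - G)"
    using less by linarith
  have "2 ^ 9 \<le> exp (1 :: real) ^ 9"
    using exp_ge_add_one_self[of 1] by (intro power_mono) auto
  also have "\<dots> = exp 9"
    by (simp flip: exp_of_nat_mult)
  also have "\<dots> \<le> exp (9 / 10 * h)"
    using h by simp
  finally have "exp (h / 10) * 2 \<le> exp (h / 10) * (9 / 100 * exp (9 / 10 * h))"
    by (intro mult_left_mono) auto
  also have "\<dots> = 9 / 100 * exp h"
    by (simp flip: exp_add)
  finally have gain: "exp (h / 10) * 2 \<le> 9 / 100 * exp h" .
  have "exp (h / 10) * measure sym_exp_prod A \<le> exp (h / 10) * 2 * measure sym_exp_prod (A - G)"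
    using half by simp
  also have "\<dots> \<le> 9 / 100 * exp h * measure sym_exp_prod (A - G)"
    using gain by (intro mult_right_mono) auto
  also have "\<dots> \<le> measure sym_exp_prod (one_coordinate_step h (A - G))"
    by (rule measure_one_coordinate_step) (use h in \<open>auto simp: G_def\<close>)
  finally show "exp (h / 10) * measure sym_exp_prod A
      \<le> measure sym_exp_prod (one_coordinate_step h (A - G))" .
qed

lemma add_dilate_lp_ball_1_trans:
  assumes "A' \<subseteq> A + dilate s (lp_ball 1)" "A'' \<subseteq> A' + dilate t (lp_ball 1)" "s > 0" "t > 0"
  shows "A'' \<subseteq> A + dilate (s + t) (lp_ball 1)"
proof
  fix x assume "x \<in> A''"
  then obtain y where y: "y \<in> A'" "l1_norm (x - y) \<le> t"
    using assms by (auto simp: add_dilate_lp_ball_1)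
  then obtain a where a: "a \<in> A" "l1_norm (y - a) \<le> s"
    using assms by (auto simp: add_dilate_lp_ball_1)
  have "l1_norm (x - a) \<le> s + t"
    using l1_norm_triangle[of "x - y" "y - a"] y a by simp
  then show "x \<in> A + dilate (s + t) (lp_ball 1)"
    using a assms by (auto simp: add_dilate_lp_ball_1)
qed

text \<open>The second alternative persists once it has occurred, since the Minkowski sums increase. While
  it has not occurred, either the current set falls under \<open>growth_step\<close> or its part in the ball, of
  at least half its measure, is a witness for the second alternative.\<close>

lemma growth_iterate:
  fixes A :: "(real ^ 'n) set"
  defines "G \<equiv> {x :: real ^ 'n. sq_norm x \<le> 2500 * real CARD('n)}"
  assumes A [measurable]: "A \<in> sets borel" and h: "10 \<le> h" "h \<le> 20" and "m > 0"
  shows "(\<exists>A'\<in>sets borel. A' \<subseteq> A + dilate (real m * h) (lp_ball 1)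
        \<and> exp (real m * h / 10) * measure sym_exp_prod A \<le> measure sym_exp_prod A')
    \<or> (\<exists>A'\<in>sets borel. A' \<subseteq> (A + dilate (real m * h) (lp_ball 1)) \<inter> G
        \<and> 1 / 2 * measure sym_exp_prod A \<le> measure sym_exp_prod A')"
  using \<open>m > 0\<close>
proof (induction m rule: nat_induct_non_zero)
  have [measurable]: "G \<in> sets borel"
    unfolding G_def by measurable
  case 1
  show ?case
  proof (cases "measure sym_exp_prod (A \<inter> G) \<le> 1 / 2 * measure sym_exp_prod A")
    case True
    then obtain A' where "A' \<in> sets borel" "A' \<subseteq> A + dilate h (lp_ball 1)"
      "exp (h / 10) * measure sym_exp_prod A \<le> measure sym_exp_prod A'"
      using growth_step[OF A h] unfolding G_def by blast
    then show ?thesis by auto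
  next
    case False
    moreover have "A \<subseteq> A + dilate h (lp_ball 1)"
      using h by (force simp: add_dilate_lp_ball_1 l1_norm_def)
    ultimately show ?thesis
      by (intro disjI2 bexI[of _ "A \<inter> G"]) auto
  qed
next
  have [measurable]: "G \<in> sets borel"
    unfolding G_def by measurable
  case (Suc m)
  have mh: "real m * h > 0" "real (Suc m) * h = real m * h + h"
    using Suc.hyps h by (auto simp: algebra_simps)
  have mono: "A + dilate (real m * h) (lp_ball 1) \<subseteq> A + dilate (real (Suc m) * h) (lp_ball 1)"
    unfolding mh(2) using mh(1) h by (force simp: add_dilate_lp_ball_1)
  from Suc.IH show ?case
  proof (elim disjE bexE conjE)
    fix A' assume A' [measurable]: "A' \<in> sets borel"
      and sub: "A' \<subseteq> A + dilate (real m * h) (lp_ball 1)"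
      and growth: "exp (real m * h / 10) * measure sym_exp_prod A \<le> measure sym_exp_prod A'"
    show ?case
    proof (cases "measure sym_exp_prod (A' \<inter> G) \<le> 1 / 2 * measure sym_exp_prod A'")
      case True
      then obtain A'' where A'': "A'' \<in> sets borel" "A'' \<subseteq> A' + dilate h (lp_ball 1)"
        "exp (h / 10) * measure sym_exp_prod A' \<le> measure sym_exp_prod A''"
        using growth_step[OF A' h] unfolding G_def by blast
      have "exp (real (Suc m) * h / 10) * measure sym_exp_prod A
          = exp (h / 10) * (exp (real m * h / 10) * measure sym_exp_prod A)"
        unfolding mh(2) by (simp add: add_divide_distrib exp_add)
      also have "\<dots> \<le> exp (h / 10) * measure sym_exp_prod A'"
        using growth by simp
      also note A''(3)
      finally have "exp (real (Suc m) * h / 10) * measure sym_exp_prod A \<le> measure sym_exp_prod A''" .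
      moreover have "A'' \<subseteq> A + dilate (real (Suc m) * h) (lp_ball 1)"
        unfolding mh(2) using add_dilate_lp_ball_1_trans[OF sub A''(2)] mh(1) h by simp
      ultimately show ?thesis
        using A''(1) by blast
    next
      case False
      have "1 * measure sym_exp_prod A \<le> exp (real m * h / 10) * measure sym_exp_prod A"
        using mh(1) by (intro mult_right_mono) auto
      then have "1 / 2 * measure sym_exp_prod A \<le> measure sym_exp_prod (A' \<inter> G)"
        using False growth by linarith
      then show ?thesis
        using sub mono by (intro disjI2 bexI[of _ "A' \<inter> G"]) auto
    qed
  next
    fix A' assume "A' \<in> sets borel" "A' \<subseteq> (A + dilate (real m * h) (lp_ball 1)) \<inter> G"
      "1 / 2 * measure sym_exp_prod A \<le> measure sym_exp_prod A'"
    then show ?case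
      using mono by blast
  qed
qed

section \<open>Measurability of the Minkowski sum\<close>

definition l1_dist :: "(real ^ 'n) set \<Rightarrow> real ^ 'n \<Rightarrow> real" where
  "l1_dist A x = (INF a\<in>A. l1_norm (x - a))"

lemma l1_norm_nonneg: "0 \<le> l1_norm x"
  by (simp add: l1_norm_def sum_nonneg)

lemma l1_dist_le: "a \<in> A \<Longrightarrow> l1_dist A x \<le> l1_norm (x - a)"
  unfolding l1_dist_def by (intro cINF_lower bdd_belowI2[of _ 0] l1_norm_nonneg)

lemma l1_dist_less_iff: "A \<noteq> {} \<Longrightarrow> l1_dist A x < r \<longleftrightarrow> (\<exists>a\<in>A. l1_norm (x - a) < r)"
  unfolding l1_dist_def by (intro cINF_less_iff bdd_belowI2[of _ 0] l1_norm_nonneg)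

lemma l1_dist_lipschitz:
  assumes "A \<noteq> {}"
  shows "l1_dist A x \<le> l1_norm (x - y) + l1_dist A y"
proof -
  have "l1_dist A x - l1_norm (x - y) \<le> l1_dist A y"
    unfolding l1_dist_def[of _ y]
  proof (rule cINF_greatest[OF assms])
    fix a assume "a \<in> A"
    then show "l1_dist A x - l1_norm (x - y) \<le> l1_norm (y - a)"
      using l1_dist_le[of a A x] l1_norm_triangle[of "x - y" "y - a"] by simp
  qed
  then show ?thesis by simp
qed

lemma l1_dist_measurable:
  assumes "A \<noteq> {}"
  shows "l1_dist A \<in> borel_measurable borel"
proof (rule borel_measurableI_less)
  fix r
  have "{x \<in> space borel. l1_dist A x < r} = (\<Union>a\<in>A. {x. l1_norm (x - a) < r})"
    using assms by (auto simp: l1_dist_less_iff)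
  moreover have "open {x :: real ^ 'n. l1_norm (x - a) < r}" for a
    by (intro open_Collect_less continuous_intros)
  ultimately show "{x \<in> space borel. l1_dist A x < r} \<in> sets borel"
    by (simp only:) (intro borel_open open_UN ballI)
qed

lemma null_sets_sym_exp_prod_shift:
  assumes "N \<in> null_sets sym_exp_prod"
  shows "{x :: real ^ 'n. x + axis i s \<in> N} \<in> null_sets sym_exp_prod"
proof -
  have [measurable]: "N \<in> sets borel"
    using assms by auto
  have "emeasure sym_exp_prod {x. x + axis i s \<in> N}
      = (\<integral>\<^sup>+x. indicator N (x + axis i s) \<partial>sym_exp_prod)"
  proof -
    have "indicator N (x + axis i s) = (indicator {x. x + axis i s \<in> N} x :: ennreal)" for x
      by (simp split: split_indicator)
    then show ?thesis by simp
  qed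
  also have "\<dots> = (\<integral>\<^sup>+x. indicator N x * ennreal (exp (\<bar>x $ i\<bar> - \<bar>x $ i - s\<bar>)) \<partial>sym_exp_prod)"
    by (rule nn_integral_sym_exp_prod_shift) measurable
  also have "\<dots> = 0"
    using AE_not_in[OF assms] by (subst nn_integral_0_iff_AE) auto
  finally show ?thesis by auto
qed

text \<open>For \<open>x\<close> in the Minkowski sum at distance exactly \<open>t\<close> from \<open>A\<close>, some \<open>a \<in> A\<close> is at distance \<open>t\<close>
  from \<open>x\<close>, and one of the \<open>n\<close> coordinates of \<open>x - a\<close> has modulus at least \<open>t / n\<close>. Moving this
  coordinate of \<open>x\<close> by \<open>s < t / n\<close> towards \<open>a\<close> shortens the distance to \<open>a\<close> by \<open>s\<close>, and no move of
  length \<open>s\<close> can shorten the distance to \<open>A\<close> by more; so \<open>x\<close> lands on the level set \<open>t - s\<close>. This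
  level set is null for a suitable \<open>s\<close>, since the distribution of the distance has only countably
  many atoms.\<close>

lemma add_l1_ball_in_completion:
  fixes A :: "(real ^ 'n) set"
  assumes "t > 0"
  shows "A + dilate t (lp_ball 1) \<in> sets (completion sym_exp_prod)"
proof (cases "A = {}")
  case True
  then show ?thesis by (simp add: set_plus_def)
next
  case False
  note [measurable] = l1_dist_measurable[OF False]
  let ?n = "real CARD('n)"
  interpret dist: prob_space "distr sym_exp_prod borel (l1_dist A)"
    by (rule sym_exp_prod.prob_space_distr) simp
  have "uncountable {t - t / ?n<..<t}"
    using assms by (simp add: uncountable_open_interval)
  then have "\<not> {t - t / ?n<..<t} \<subseteq> {r. measure (distr sym_exp_prod borel (l1_dist A)) {r} \<noteq> 0}"
    using dist.countable_support countable_subset by blast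
  then obtain r where r: "t - t / ?n < r" "r < t"
      and r0: "measure (distr sym_exp_prod borel (l1_dist A)) {r} = 0"
    by auto
  have "emeasure sym_exp_prod {x. l1_dist A x = r} = 0"
    using r0 by (subst (asm) measure_distr) (auto simp: sym_exp_prod.emeasure_eq_measure vimage_def)
  then have null: "{x. l1_dist A x = r} \<in> null_sets sym_exp_prod"
    by (intro null_setsI) simp_all
  define s where "s = t - r"
  define N where "N = (\<Union>i. \<Union>\<sigma>\<in>{-1, 1}. {x. x + axis i (\<sigma> * s) \<in> {x. l1_dist A x = r}})"
  have N: "N \<in> null_sets sym_exp_prod"
    unfolding N_def by (intro null_sets_UN' null_sets_sym_exp_prod_shift null) auto
  have sphere: "{x \<in> A + dilate t (lp_ball 1). l1_dist A x = t} \<subseteq> N"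
  proof
    fix x assume "x \<in> {x \<in> A + dilate t (lp_ball 1). l1_dist A x = t}"
    then have "x \<in> A + dilate t (lp_ball 1)" and x: "l1_dist A x = t"
      by auto
    then obtain a where a: "a \<in> A" "l1_norm (x - a) = t"
      using assms l1_dist_le[of _ A x] by (force simp: add_dilate_lp_ball_1)
    obtain i where i: "\<bar>x $ i - a $ i\<bar> \<ge> t / ?n"
    proof (rule ccontr)
      assume "\<not> thesis"
      then have "(\<Sum>i\<in>UNIV. \<bar>x $ i - a $ i\<bar>) < (\<Sum>i\<in>(UNIV :: 'n set). t / ?n)"
        using that by (intro sum_strict_mono) (auto simp: not_le[symmetric])
      then show False
        using a by (simp add: l1_norm_def)
    qed
    define \<sigma> :: real where "\<sigma> = (if x $ i \<ge> a $ i then -1 else 1)"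
    let ?y = "x + axis i (\<sigma> * s)"
    have s: "0 < s" "s < t / ?n"
      using r by (auto simp: s_def)
    have "\<bar>(?y - a) $ j\<bar> = \<bar>(x - a) $ j\<bar> - (if j = i then s else 0)" for j
      using i s by (auto simp: \<sigma>_def axis_def)
    then have "l1_norm (?y - a) = l1_norm (x - a) - s"
      by (simp add: l1_norm_def sum_subtractf)
    then have "l1_dist A ?y \<le> r"
      using l1_dist_le[OF a(1), of ?y] a by (simp add: s_def)
    moreover have "l1_norm (x - ?y) = s"
      using s l1_norm_minus_commute[of x ?y] by (auto simp: \<sigma>_def)
    then have "r \<le> l1_dist A ?y"
      using l1_dist_lipschitz[OF False, of x ?y] x by (simp add: s_def)
    ultimately show "x \<in> N"
      unfolding N_def by (auto simp: \<sigma>_def intro!: exI[of _ i] split: if_splits)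
  qed
  have decomp: "A + dilate t (lp_ball 1)
      = {x. l1_dist A x < t} \<union> {x \<in> A + dilate t (lp_ball 1). l1_dist A x = t}"
  proof (intro set_eqI iffI)
    fix x assume x: "x \<in> A + dilate t (lp_ball 1)"
    then obtain a where "a \<in> A" "l1_norm (x - a) \<le> t"
      using assms by (auto simp: add_dilate_lp_ball_1)
    then have "l1_dist A x \<le> t"
      using l1_dist_le order_trans by blast
    then show "x \<in> {x. l1_dist A x < t} \<union> {x \<in> A + dilate t (lp_ball 1). l1_dist A x = t}"
      using x by auto
  next
    fix x assume "x \<in> {x. l1_dist A x < t} \<union> {x \<in> A + dilate t (lp_ball 1). l1_dist A x = t}"
    then show "x \<in> A + dilate t (lp_ball 1)"
    proof
      assume "x \<in> {x. l1_dist A x < t}"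
      then obtain a where "a \<in> A" "l1_norm (x - a) < t"
        using False by (auto simp: l1_dist_less_iff)
      then show ?thesis
        using assms by (auto simp: add_dilate_lp_ball_1 intro!: bexI[of _ a])
    qed simp
  qed
  show ?thesis
    by (rule sets_completionI[OF decomp sphere N]) simp
qed

section \<open>The dichotomy\<close>

theorem theorem4p6:
  fixes A :: "(real ^ 'n) set" and t :: real
  assumes "A \<in> sets borel" and "t \<ge> 10"
  shows "(sym_exp_prob ((A + dilate t (lp_ball 1)) \<inter> dilate (50 * sqrt (real CARD('n))) (lp_ball 2))
            \<ge> 1 / 2 * sym_exp_prob A
          \<or> sym_exp_prob (A + dilate t (lp_ball 1)) \<ge> exp (t / 10) * sym_exp_prob A)
       \<and> (A \<inter> (dilate (50 * sqrt (real CARD('n))) (lp_ball 2) + dilate t (lp_ball 1)) = {}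
          \<longrightarrow> sym_exp_prob (A + dilate t (lp_ball 1)) \<ge> exp (t / 10) * sym_exp_prob A)"
proof -
  let ?G = "{x :: real ^ 'n. sq_norm x \<le> 2500 * real CARD('n)}"
  let ?At = "A + dilate t (lp_ball 1)"
  have t: "t > 0" using assms by simp
  have G: "dilate (50 * sqrt (real CARD('n))) (lp_ball 2) = ?G"
    by (subst dilate_lp_ball_2) (auto simp: power_mult_distrib)
  have "?G \<in> sets borel"
    by measurable
  then have sets: "?At \<in> sets (completion sym_exp_prod)" "?At \<inter> ?G \<in> sets (completion sym_exp_prod)"
    using add_l1_ball_in_completion[OF t, of A] by (auto intro!: sets.Int)
  have le: "measure sym_exp_prod A' \<le> sym_exp_prob S"
    if "A' \<in> sets borel" "A' \<subseteq> S" "S \<in> sets (completion sym_exp_prod)" for A' S :: "(real ^ 'n) set"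
  proof -
    interpret c: prob_space "completion sym_exp_prod :: (real ^ 'n) measure"
      by (rule sym_exp_prod.prob_space_completion)
    show ?thesis
      using c.finite_measure_mono[OF that(2,3)] that(1) by simp
  qed
  have A: "sym_exp_prob A = measure sym_exp_prod A"
    using assms by simp
  \<comment> \<open>Here \<open>t \<ge> 10\<close> is used: it makes the number of steps positive, with a step length between
    \<open>10\<close> and \<open>20\<close>.\<close>
  define m where "m = nat \<lfloor>t / 10\<rfloor>"
  define h where "h = t / real m"
  have m: "m > 0" "real m \<le> t / 10" "t / 10 < real m + 1"
    using assms unfolding m_def by linarith+
  have h: "10 \<le> h" "h \<le> 20" "real m * h = t"
    using m by (auto simp: h_def field_simps)
  have main: "1 / 2 * sym_exp_prob A \<le> sym_exp_prob (?At \<inter> ?G)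
      \<or> exp (t / 10) * sym_exp_prob A \<le> sym_exp_prob ?At"
    using growth_iterate[OF assms(1) h(1,2) m(1), unfolded h(3)]
  proof (elim disjE bexE conjE)
    fix A' assume A': "A' \<in> sets borel" "A' \<subseteq> ?At"
      "exp (t / 10) * measure sym_exp_prod A \<le> measure sym_exp_prod A'"
    note A'(3)
    also have "measure sym_exp_prod A' \<le> sym_exp_prob ?At"
      using A' sets by (intro le)
    finally show ?thesis unfolding A ..
  next
    fix A' assume A': "A' \<in> sets borel" "A' \<subseteq> ?At \<inter> ?G"
      "1 / 2 * measure sym_exp_prod A \<le> measure sym_exp_prod A'"
    note A'(3)
    also have "measure sym_exp_prod A' \<le> sym_exp_prob (?At \<inter> ?G)"
      using A' sets by (intro le)
    finally show ?thesis unfolding A ..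
  qed
  \<comment> \<open>If \<open>A\<close> is too far from the ball, the first alternative says that \<open>A\<close> is null, and then the
    second one is trivial.\<close>
  have "exp (t / 10) * sym_exp_prob A \<le> sym_exp_prob ?At" if "A \<inter> (?G + dilate t (lp_ball 1)) = {}"
  proof -
    have "?At \<inter> ?G = {}"
    proof (rule ccontr)
      assume "?At \<inter> ?G \<noteq> {}"
      then obtain x a where x: "x \<in> ?G" "a \<in> A" "l1_norm (x - a) \<le> t"
        unfolding add_dilate_lp_ball_1[OF t] by auto
      then have "a \<in> ?G + dilate t (lp_ball 1)"
        unfolding add_dilate_lp_ball_1[OF t] l1_norm_minus_commute[of x a] by blast
      with \<open>a \<in> A\<close> that show False by blast
    qed
    then show ?thesis
      using main by (auto simp: measure_le_0_iff)
  qed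
  then show ?thesis
    using main unfolding G by blast
qed

end
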